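(* For all $\ell\ge 2$, the generating function $$B_{\ell,1}(x,t)=\sum_{w\in[\ell]^*}x^{1\text{-box}(w)}t^{|w|}$$ satisfies $$B_{\ell,1}(x,t) = 1 + \ell t - \vec{1}_{\ell,1}\, \mathbb{B}_{\ell,1}^{-1}\, (\vec{I}_{\ell,1})^T ,$$ where the vectors $\vec{1}_{\ell,1},\vec{I}_{\ell,1}$ and the $\ell^2\times\ell^2$ matrix $\mathbb{B}_{\ell,1}$ are as follows, with coordinates indexed by the pairs $(i,j)\in[\ell]^2$ in lexicographic order. $\vec{1}_{\ell,1}$ is the row vector of length $\ell^2$ consisting of all $1$s; $\vec{I}_{\ell,1}$ is the row vector whose $(i,j)$ entry is $x^2t^2$ if $|i-j|\le 1$ and $t^2$ if $|i-j|>1$; and $\mathbb{B}_{\ell,1}=C-\mathrm{Id}$, where $\mathrm{Id}$ is the identity matrix and $C$ is the matrix whose entry in row $(i,j)$ and column $(p,q)$ is $0$ if $p\ne j$, and, if $p=j$, is $$\begin{cases} t & \text{if } |i-j|>1,\\ xt & \text{if } |i-j|\le 1 \text{ and } |j-q|\le 1,\\ x^2t & \text{if } |i-j|\le 1\text{ and } |j-q|>1.\end{cases}$$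
   Context: $[\ell]=\{1,\ldots,\ell\}$, $[\ell]^*$ is the set of all finite words over $[\ell]$ (including the empty word), and $|w|$ is the length of $w$. For a word $w=w_1\cdots w_n$, the letter $w_i$ matches the $1$-box pattern in $w$ if $|w_i-w_{i+1}|\le 1$ (with $i+1\le n$) or $|w_{i-1}-w_i|\le 1$ (with $i-1\ge 1$); $1\text{-box}(w)$ is the number of indices $i$ such that $w_i$ matches the $1$-box pattern in $w$. The identity is one of formal power series in $t$ with coefficients in $\mathbb{Z}[x]$ (at $t=0$ the matrix $\mathbb{B}_{\ell,1}$ equals minus the identity, so it is invertible). *)

theory Defs
  imports "HOL-Analysis.Infinite_Sum" "HOL-Computational_Algebra.Polynomial"
    "Jordan_Normal_Form.Matrix"
begin

definition near :: "nat \<Rightarrow> nat \<Rightarrow> bool" where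
  "near i j \<longleftrightarrow> \<bar>int i - int j\<bar> \<le> 1"

text \<open>Positions in a word are counted from 0, whereas the letters are \<open>1, \<dots>, \<ell>\<close>.\<close>

definition matches_one_box :: "nat list \<Rightarrow> nat \<Rightarrow> bool" where
  "matches_one_box w i \<longleftrightarrow>
     (i + 1 < length w \<and> near (w ! i) (w ! (i + 1))) \<or>
     (1 \<le> i \<and> near (w ! (i - 1)) (w ! i))"

definition one_box :: "nat list \<Rightarrow> nat" where
  "one_box w = card {i. i < length w \<and> matches_one_box w i}"

text \<open>Power series in \<open>t\<close> over \<open>\<int>[x]\<close>: the variable \<open>t\<close> is \<^const>\<open>fps_X\<close>, and \<open>x\<close> is the
  following constant series.\<close>

definition var_x :: "int poly fps" where
  "var_x = fps_const [:0, 1:]"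

text \<open>The sum over all words is taken in the metric (\<open>t\<close>-adic) topology on formal power series;
  by \<open>has_sum_box_gf\<close> below, it converges.\<close>

definition box_gf :: "nat \<Rightarrow> int poly fps" where
  "box_gf l = (\<Sum>\<^sub>\<infinity>w\<in>lists {1..l}. var_x ^ one_box w * fps_X ^ length w)"

text \<open>The \<open>k\<close>-th pair of \<open>[\<ell>]\<^sup>2\<close> in lexicographic order, for \<open>k < \<ell>\<^sup>2\<close>.\<close>

definition lex_pair :: "nat \<Rightarrow> nat \<Rightarrow> nat \<times> nat" where
  "lex_pair l k = (k div l + 1, k mod l + 1)"

definition ones_vec :: "nat \<Rightarrow> int poly fps vec" where
  "ones_vec l = vec (l\<^sup>2) (\<lambda>_. 1)"

definition init_vec :: "nat \<Rightarrow> int poly fps vec" where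
  "init_vec l = vec (l\<^sup>2) (\<lambda>k. case lex_pair l k of (i, j) \<Rightarrow>
     if near i j then var_x\<^sup>2 * fps_X\<^sup>2 else fps_X\<^sup>2)"

definition C_mat :: "nat \<Rightarrow> int poly fps mat" where
  "C_mat l = mat (l\<^sup>2) (l\<^sup>2) (\<lambda>(r, c). case (lex_pair l r, lex_pair l c) of ((i, j), (p, q)) \<Rightarrow>
     if p \<noteq> j then 0
     else if \<not> near i j then fps_X
     else if near j q then var_x * fps_X
     else var_x\<^sup>2 * fps_X)"

definition B_mat :: "nat \<Rightarrow> int poly fps mat" where
  "B_mat l = C_mat l - 1\<^sub>m (l\<^sup>2)"

text \<open>The two-sided inverse over an arbitrary ring, meaningful if \<^term>\<open>invertible_mat A\<close>.\<close>

definition mat_inv :: "'a :: semiring_1 mat \<Rightarrow> 'a mat" where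
  "mat_inv A = (THE A'. inverts_mat A A' \<and> inverts_mat A' A)"

lemma mat_inv_eqI:
  assumes "inverts_mat A A'" "inverts_mat A' A"
  shows "mat_inv A = A'"
  unfolding mat_inv_def
proof (rule the_equality)
  show "inverts_mat A A' \<and> inverts_mat A' A" using assms by simp
next
  fix D assume D: "inverts_mat A D \<and> inverts_mat D A"
  have dims: "dim_col A' = dim_row A" "dim_col A = dim_row A'"
    "dim_col D = dim_row A" "dim_col A = dim_row D"
    using assms D unfolding inverts_mat_def by (metis index_mult_mat(3) index_one_mat(3))+
  have "D = (1\<^sub>m (dim_row A')) * D"
    using dims by (intro eq_matI) auto
  also have "\<dots> = (A' * A) * D" using assms unfolding inverts_mat_def by simp
  also have "\<dots> = A' * (A * D)"
    using dims by (intro assoc_mult_mat[of _ "dim_row A'" "dim_row A" _ "dim_row A'" _ "dim_row A"]) auto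
  also have "\<dots> = A' * 1\<^sub>m (dim_row A)" using D unfolding inverts_mat_def by simp
  also have "\<dots> = A'" using dims by (intro eq_matI) auto
  finally show "D = A'" .
qed

lemma has_sum_box_gf_coeffs:
  "((\<lambda>w. var_x ^ one_box w * fps_X ^ length w) has_sum
     Abs_fps (\<lambda>n. \<Sum>w | w \<in> lists {1..l} \<and> length w = n. [:0, 1:] ^ one_box w)) (lists {1..l})"
  unfolding has_sum_def tendsto_fps_iff
proof
  fix n
  let ?W = "{w. set w \<subseteq> {1..l} \<and> length w = n}"
  have fin: "finite ?W" by (rule finite_lists_length_eq) simp
  have nth: "fps_nth (var_x ^ one_box w * fps_X ^ length w) n =
      (if length w = n then [:0, 1:] ^ one_box w else 0)" for w
    by (simp add: var_x_def fps_const_power fps_X_power_mult_right_nth)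
  show "\<forall>\<^sub>F F in finite_subsets_at_top (lists {1..l}).
      fps_nth (\<Sum>w\<in>F. var_x ^ one_box w * fps_X ^ length w) n =
      fps_nth (Abs_fps (\<lambda>n. \<Sum>w | w \<in> lists {1..l} \<and> length w = n. [:0, 1:] ^ one_box w)) n"
    unfolding eventually_finite_subsets_at_top
  proof (intro exI[of _ ?W] conjI allI impI)
    fix F assume F: "finite F \<and> ?W \<subseteq> F \<and> F \<subseteq> lists {1..l}"
    have eq: "{w. w \<in> lists {1..l} \<and> length w = n} = {w \<in> F. length w = n}"
      using F by (auto simp: in_lists_conv_set)
    show "fps_nth (\<Sum>w\<in>F. var_x ^ one_box w * fps_X ^ length w) n =
      fps_nth (Abs_fps (\<lambda>n. \<Sum>w | w \<in> lists {1..l} \<and> length w = n. [:0, 1:] ^ one_box w)) n"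
      using F by (simp only: fps_sum_nth nth fps_nth_Abs_fps eq) (simp add: sum.inter_filter)
  qed (use fin in auto)
qed

lemma has_sum_box_gf:
  "((\<lambda>w. var_x ^ one_box w * fps_X ^ length w) has_sum box_gf l) (lists {1..l})"
  unfolding box_gf_def
  by (rule has_sum_infsum) (use has_sum_box_gf_coeffs in \<open>auto simp: summable_on_def\<close>)

lemma fps_nth_box_gf:
  "fps_nth (box_gf l) n = (\<Sum>w | w \<in> lists {1..l} \<and> length w = n. [:0, 1:] ^ one_box w)"
  unfolding box_gf_def infsumI[OF has_sum_box_gf_coeffs] fps_nth_Abs_fps ..

end

theory Submission
  imports Defs
begin

text \<open>Prepending a letter \<open>i\<close> to a word that begins with \<open>j q\<close> changes the number of matches by an
  amount that depends only on \<open>i\<close>, \<open>j\<close>, \<open>q\<close>. Hence the vector \<open>b\<close> of generating functions of the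
  words beginning with a given pair satisfies \<open>b = I + C b\<close>, that is, \<open>B b = - I\<close>. Since \<open>C\<close> is
  \<open>t\<close> times a matrix over the coefficient ring, the geometric series inverts \<open>Id - C\<close>.\<close>

section \<open>Neumann series: a two-sided inverse of \<open>t M - Id\<close>\<close>

definition geometric_mat :: "'a::comm_ring_1 mat \<Rightarrow> 'a fps mat" where
  "geometric_mat M = mat (dim_row M) (dim_row M) (\<lambda>(i, j). Abs_fps (\<lambda>n. (M ^\<^sub>m n) $$ (i, j)))"

lemma geometric_mat_carrier [simp]:
  "M \<in> carrier_mat k k \<Longrightarrow> geometric_mat M \<in> carrier_mat k k"
  by (auto simp: geometric_mat_def)

text \<open>\<open>pow_mat\<close> recurses by multiplying on the right; the left-handed form serves
  the first of the two identities below.\<close>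

lemma pow_mat_Suc_left:
  assumes "(M :: 'a::semiring_1 mat) \<in> carrier_mat k k"
  shows "M ^\<^sub>m Suc n = M * M ^\<^sub>m n"
proof (induction n)
  case 0
  then show ?case using assms by simp
next
  case (Suc n)
  have "M ^\<^sub>m Suc (Suc n) = (M * M ^\<^sub>m n) * M" using Suc by simp
  also have "\<dots> = M * (M ^\<^sub>m n * M)"
    using assms by (intro assoc_mult_mat) (auto intro: pow_carrier_mat)
  finally show ?case by simp
qed

text \<open>Compare coefficients of t: at 0 only the identity contributes, and at n + 1 the product
  with \<open>C\<close> gives \<open>M\<close> times the n-th power of \<open>M\<close>, on either
  side. Both orders are shown because \<open>mat_inv\<close> asks for a two-sided inverse.\<close>

lemma geometric_mat_eq:
  fixes M :: "'a::comm_ring_1 mat"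
  assumes M: "M \<in> carrier_mat k k"
  defines "C \<equiv> map_mat (\<lambda>a. fps_X * fps_const a) M"
  shows "geometric_mat M = 1\<^sub>m k + C * geometric_mat M"
    and "geometric_mat M = 1\<^sub>m k + geometric_mat M * C"
proof -
  have pw: "M ^\<^sub>m n \<in> carrier_mat k k" for n using M by (rule pow_carrier_mat)
  have nth_X: "fps_nth (fps_X * f) n = (if n = 0 then 0 else fps_nth f (n - 1))"
    for f :: "'a fps" and n by simp
  show "geometric_mat M = 1\<^sub>m k + C * geometric_mat M"
  proof (rule eq_matI)
    fix i j assume "i < dim_row (1\<^sub>m k + C * geometric_mat M)"
      "j < dim_col (1\<^sub>m k + C * geometric_mat M)"
    then have ij: "i < k" "j < k" using M by (auto simp: C_def geometric_mat_def)
    have step: "(M ^\<^sub>m Suc n) $$ (i, j) = (\<Sum>m<k. M $$ (i, m) * (M ^\<^sub>m n) $$ (m, j))" for n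
      unfolding pow_mat_Suc_left[OF M] using M pw[of n] ij
      by (auto simp: scalar_prod_def atLeast0LessThan)
    have "fps_nth (geometric_mat M $$ (i, j)) n =
        fps_nth ((1\<^sub>m k + C * geometric_mat M) $$ (i, j)) n" for n
      using M ij step
      by (cases n) (auto simp: C_def geometric_mat_def scalar_prod_def atLeast0LessThan
          fps_sum_nth mult.assoc nth_X simp del: pow_mat.simps(2))
    then show "geometric_mat M $$ (i, j) = (1\<^sub>m k + C * geometric_mat M) $$ (i, j)"
      by (rule fps_ext)
  qed (use M in \<open>auto simp: C_def geometric_mat_def\<close>)
  show "geometric_mat M = 1\<^sub>m k + geometric_mat M * C"
  proof (rule eq_matI)
    fix i j assume "i < dim_row (1\<^sub>m k + geometric_mat M * C)"
      "j < dim_col (1\<^sub>m k + geometric_mat M * C)"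
    then have ij: "i < k" "j < k" using M by (auto simp: C_def geometric_mat_def)
    have step: "(M ^\<^sub>m Suc n) $$ (i, j) = (\<Sum>m<k. (M ^\<^sub>m n) $$ (i, m) * M $$ (m, j))" for n
      using M pw[of n] ij by (auto simp: scalar_prod_def atLeast0LessThan)
    have "fps_nth (geometric_mat M $$ (i, j)) n =
        fps_nth ((1\<^sub>m k + geometric_mat M * C) $$ (i, j)) n" for n
      using M ij step
      by (cases n) (auto simp: C_def geometric_mat_def scalar_prod_def atLeast0LessThan
          fps_sum_nth mult.left_commute[of _ fps_X] nth_X simp del: pow_mat.simps(2))
    then show "geometric_mat M $$ (i, j) = (1\<^sub>m k + geometric_mat M * C) $$ (i, j)"
      by (rule fps_ext)
  qed (use M in \<open>auto simp: C_def geometric_mat_def\<close>)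
qed

lemma geometric_mat_inverse:
  fixes M :: "'a::comm_ring_1 mat"
  assumes M: "M \<in> carrier_mat k k"
  defines "B \<equiv> map_mat (\<lambda>a. fps_X * fps_const a) M - 1\<^sub>m k"
  shows "B * (- geometric_mat M) = 1\<^sub>m k" "(- geometric_mat M) * B = 1\<^sub>m k"
proof -
  let ?C = "map_mat (\<lambda>a. fps_X * fps_const a) M :: 'a fps mat"
  let ?N = "geometric_mat M"
  have C: "?C \<in> carrier_mat k k" and N: "?N \<in> carrier_mat k k" using M by auto
  \<comment> \<open>With \<open>P\<close> the geometric series and \<open>Q\<close> its product with
    t M, this turns the fixed point equation into the inverse property. The sign is there because B
    is C - Id, not Id - C.\<close>
  have cancel: "- (Q - P) = 1\<^sub>m k"
    if "P = 1\<^sub>m k + Q" "P \<in> carrier_mat k k" "Q \<in> carrier_mat k k" for P Q :: "'a fps mat"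
    using that by (intro eq_matI) auto
  have CN: "?C * ?N \<in> carrier_mat k k" and NC: "?N * ?C \<in> carrier_mat k k"
    using mult_carrier_mat[OF C N] mult_carrier_mat[OF N C] .
  have B: "B \<in> carrier_mat k k" unfolding B_def by (intro minus_carrier_mat one_carrier_mat)
  have "B * (- ?N) = - (B * ?N)"
    using B N by auto
  also have "B * ?N = ?C * ?N - ?N"
    unfolding B_def using minus_mult_distrib_mat[OF C one_carrier_mat N] N by simp
  finally show "B * (- ?N) = 1\<^sub>m k"
    using cancel[OF geometric_mat_eq(1)[OF M] N CN] by simp
  have "(- ?N) * B = - (?N * B)"
    using B N by auto
  also have "?N * B = ?N * ?C - ?N"
    unfolding B_def using mult_minus_distrib_mat[OF N C one_carrier_mat] N by simp
  finally show "(- ?N) * B = 1\<^sub>m k"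
    using cancel[OF geometric_mat_eq(2)[OF M] N NC] by simp
qed

section \<open>The statistic \<open>one_box\<close> when a letter is prepended\<close>

lemma one_box_eq_sum: "one_box w = (\<Sum>i<length w. of_bool (matches_one_box w i))"
  by (auto simp: one_box_def intro!: arg_cong[where f = card])

lemma one_box_Nil [simp]: "one_box [] = 0"
  by (simp add: one_box_eq_sum)

lemma one_box_single [simp]: "one_box [i] = 0"
  by (simp add: one_box_eq_sum matches_one_box_def)

lemma one_box_pair: "one_box [i, j] = (if near i j then 2 else 0)"
  by (simp add: one_box_eq_sum matches_one_box_def)

definition box_incr :: "nat \<Rightarrow> nat \<Rightarrow> nat \<Rightarrow> nat" where
  "box_incr i j q = (if \<not> near i j then 0 else if near j q then 1 else 2)"

text \<open>From the third position on, the neighbours of a letter are unchanged, so only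
  \<open>i\<close> and \<open>j\<close> can add matches. If \<open>near i j\<close>, the new letter
  matches, and \<open>j\<close> becomes a new match exactly when it did not already match through
  \<open>q\<close>.\<close>

lemma one_box_Cons: "one_box (i # j # q # v) = box_incr i j q + one_box (j # q # v)"
proof -
  have "matches_one_box (i # j # q # v) (Suc (Suc m)) = matches_one_box (j # q # v) (Suc m)" for m
    by (simp add: matches_one_box_def)
  moreover have "matches_one_box (i # j # q # v) 0 = near i j"
    "matches_one_box (i # j # q # v) (Suc 0) = (near i j \<or> near j q)"
    "matches_one_box (j # q # v) 0 = near j q"
    by (auto simp: matches_one_box_def)
  ultimately show ?thesis
    by (simp add: one_box_eq_sum sum.lessThan_Suc_shift box_incr_def del: sum.lessThan_Suc)
qed

section \<open>Sums over words and over lexicographically indexed pairs\<close>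

lemma sum_lists_length_Suc:
  assumes "finite A"
  shows "(\<Sum>w | w \<in> lists A \<and> length w = Suc n. f w) =
    (\<Sum>a\<in>A. \<Sum>v | v \<in> lists A \<and> length v = n. f (a # v))"
proof -
  have "{w. w \<in> lists A \<and> length w = Suc n} =
      (\<lambda>(a, v). a # v) ` (A \<times> {v. v \<in> lists A \<and> length v = n})"
    by (auto simp: length_Suc_conv image_iff)
  then show ?thesis
    by (simp add: sum.cartesian_product sum.reindex inj_on_def case_prod_unfold)
qed

lemma sum_lex_pair:
  "(\<Sum>k<l\<^sup>2. f (lex_pair l k)) = (\<Sum>i=1..l. \<Sum>j=1..l. f (i, j))"
proof (cases "l = 0")
  case False
  have "(\<Sum>k<l\<^sup>2. f (lex_pair l k)) = (\<Sum>p\<in>{1..l} \<times> {1..l}. f p)"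
  \<comment> \<open>Division with remainder by \<open>l\<close>, shifted by 1 since letters start at
    1; the inverse reads a pair as a two-digit number in base \<open>l\<close>.\<close>
  proof (rule sum.reindex_bij_witness[where j = "lex_pair l"
          and i = "\<lambda>(i, j). (i - 1) * l + (j - 1)"], goal_cases)
    case (2 k)
    then show ?case
      using False by (auto simp: lex_pair_def power2_eq_square less_mult_imp_div_less Suc_le_eq)
  next
    case (4 p)
    then obtain i j where p: "p = (Suc i, Suc j)" "i < l" "j < l"
      by (metis SigmaE Suc_le_eq atLeastAtMost_iff One_nat_def Suc_pred)
    have "i * l + j < (i + 1) * l" using p by simp
    also have "\<dots> \<le> l * l" using p by (intro mult_right_mono) auto
    finally show ?case using p by (simp add: power2_eq_square)
  next
    case (3 p)
    then obtain i j where p: "p = (Suc i, Suc j)" "i < l" "j < l"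
      by (metis SigmaE Suc_le_eq atLeastAtMost_iff One_nat_def Suc_pred)
    then show ?case by (simp add: lex_pair_def)
  qed (auto simp: lex_pair_def)
  then show ?thesis by (simp add: sum.cartesian_product)
qed simp

section \<open>The transfer matrix and its linear system\<close>

definition step_mat :: "nat \<Rightarrow> int poly mat" where
  "step_mat l = mat (l\<^sup>2) (l\<^sup>2) (\<lambda>(r, c). case (lex_pair l r, lex_pair l c) of ((i, j), (p, q)) \<Rightarrow>
     if p = j then [:0, 1:] ^ box_incr i j q else 0)"

lemma step_mat_carrier [simp]: "step_mat l \<in> carrier_mat (l\<^sup>2) (l\<^sup>2)"
  by (simp add: step_mat_def)

text \<open>Pulling out t leaves a matrix over Z[x], as \<open>geometric_mat_inverse\<close>
  requires; the exponents of x in C are exactly the values of \<open>box_incr\<close>.\<close>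

lemma C_mat_eq: "C_mat l = map_mat (\<lambda>a. fps_X * fps_const a) (step_mat l)"
  by (rule eq_matI)
    (auto simp: C_mat_def step_mat_def box_incr_def var_x_def mult.commute
      split: prod.splits simp flip: fps_const_power)

text \<open>The index \<open>n\<close> counts only the letters after the initial pair, so the words
  have length n + 2.\<close>

definition pair_count :: "nat \<Rightarrow> nat \<Rightarrow> nat \<times> nat \<Rightarrow> int poly" where
  "pair_count l n = (\<lambda>(i, j). \<Sum>v | v \<in> lists {1..l} \<and> length v = n. [:0, 1:] ^ one_box (i # j # v))"

lemma pair_count_0: "pair_count l 0 (i, j) = (if near i j then [:0, 1:]\<^sup>2 else 1)"
proof -
  have "{v. v \<in> lists {1..l} \<and> length v = 0} = {[]}" by auto
  then show ?thesis unfolding pair_count_def by (simp add: one_box_pair)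
qed

lemma pair_count_Suc:
  "pair_count l (Suc n) (i, j) = (\<Sum>q=1..l. [:0, 1:] ^ box_incr i j q * pair_count l n (j, q))"
  by (simp add: pair_count_def sum_lists_length_Suc one_box_Cons power_add sum_distrib_left)

lemma pair_count_Suc_lex_pair:
  assumes "r < l\<^sup>2"
  shows "pair_count l (Suc n) (lex_pair l r) =
    (\<Sum>c<l\<^sup>2. step_mat l $$ (r, c) * pair_count l n (lex_pair l c))"
proof -
  obtain i j where ij: "lex_pair l r = (i, j)" by fastforce
  have "l > 0" using assms by (cases "l = 0") auto
  \<comment> \<open>This guarantees that the sum over \<open>p\<close> below really meets its one
    nonzero term, \<open>p = j\<close>.\<close>
  then have j: "j \<in> {1..l}" using ij by (auto simp: lex_pair_def Suc_le_eq)
  let ?f = "\<lambda>(p, q). if p = j then [:0, 1:] ^ box_incr i j q * pair_count l n (p, q) else 0"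
  have "(\<Sum>c<l\<^sup>2. step_mat l $$ (r, c) * pair_count l n (lex_pair l c)) =
      (\<Sum>c<l\<^sup>2. ?f (lex_pair l c))"
    using assms ij by (intro sum.cong) (auto simp: step_mat_def split: prod.splits)
  also have "\<dots> = (\<Sum>p=1..l. \<Sum>q=1..l. ?f (p, q))"
    by (rule sum_lex_pair)
  also have "\<dots> = (\<Sum>p=1..l. if p = j then pair_count l (Suc n) (i, j) else 0)"
    by (intro sum.cong) (auto simp: pair_count_Suc)
  also have "\<dots> = pair_count l (Suc n) (i, j)"
    using j by simp
  finally show ?thesis using ij by simp
qed

text \<open>The vector b of the overview; the factor t^2 accounts for the two initial
  letters.\<close>

definition pair_gf_vec :: "nat \<Rightarrow> int poly fps vec" where
  "pair_gf_vec l = vec (l\<^sup>2) (\<lambda>k. fps_X\<^sup>2 * Abs_fps (\<lambda>n. pair_count l n (lex_pair l k)))"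

lemma pair_gf_vec_carrier [simp]: "pair_gf_vec l \<in> carrier_vec (l\<^sup>2)"
  by (simp add: pair_gf_vec_def)

lemma pair_gf_vec_eq: "pair_gf_vec l = init_vec l + C_mat l *\<^sub>v pair_gf_vec l"
proof (rule eq_vecI)
  fix r assume "r < dim_vec (init_vec l + C_mat l *\<^sub>v pair_gf_vec l)"
  then have r: "r < l\<^sup>2" by (simp add: C_mat_def)
  let ?u = "\<lambda>k. Abs_fps (\<lambda>n. pair_count l n (lex_pair l k))"
  \<comment> \<open>The equation b = I + C b with t^2 divided out: the constant term comes from the
    two-letter word, the rest from the recursion in \<open>n\<close>.\<close>
  have u: "?u r = fps_const (pair_count l 0 (lex_pair l r)) +
      fps_X * (\<Sum>c<l\<^sup>2. fps_const (step_mat l $$ (r, c)) * ?u c)"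
  proof (rule fps_ext)
    fix n
    show "fps_nth (?u r) n = fps_nth (fps_const (pair_count l 0 (lex_pair l r)) +
      fps_X * (\<Sum>c<l\<^sup>2. fps_const (step_mat l $$ (r, c)) * ?u c)) n"
      using pair_count_Suc_lex_pair[OF r] by (cases n) (auto simp: fps_sum_nth)
  qed
  have init: "init_vec l $ r = fps_X\<^sup>2 * fps_const (pair_count l 0 (lex_pair l r))"
    using r by (auto simp: init_vec_def pair_count_0 var_x_def simp flip: fps_const_power
        split: prod.splits)
  have "(C_mat l *\<^sub>v pair_gf_vec l) $ r =
      (\<Sum>c<l\<^sup>2. fps_X * fps_const (step_mat l $$ (r, c)) * (fps_X\<^sup>2 * ?u c))"
    using r unfolding C_mat_eq
    by (auto simp: scalar_prod_def pair_gf_vec_def step_mat_def atLeast0LessThan intro!: sum.cong)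
  also have "\<dots> = fps_X\<^sup>2 * (fps_X * (\<Sum>c<l\<^sup>2. fps_const (step_mat l $$ (r, c)) * ?u c))"
    by (simp add: sum_distrib_left algebra_simps)
  finally have "(init_vec l + C_mat l *\<^sub>v pair_gf_vec l) $ r = fps_X\<^sup>2 * ?u r"
    using r init by (subst u) (simp add: C_mat_def algebra_simps)
  then show "pair_gf_vec l $ r = (init_vec l + C_mat l *\<^sub>v pair_gf_vec l) $ r"
    using r by (simp add: pair_gf_vec_def)
qed (simp add: pair_gf_vec_def C_mat_def)

lemma B_mat_carrier: "B_mat l \<in> carrier_mat (l\<^sup>2) (l\<^sup>2)"
  unfolding B_mat_def by (intro minus_carrier_mat one_carrier_mat)

lemma B_mat_mult_pair_gf_vec: "B_mat l *\<^sub>v (- pair_gf_vec l) = init_vec l"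
proof -
  let ?b = "pair_gf_vec l"
  have C: "C_mat l \<in> carrier_mat (l\<^sup>2) (l\<^sup>2)" by (simp add: C_mat_def)
  have "B_mat l *\<^sub>v (- ?b) = - (B_mat l *\<^sub>v ?b)"
    using B_mat_carrier[of l] by (intro eq_vecI) (auto simp: pair_gf_vec_def)
  also have "B_mat l *\<^sub>v ?b = C_mat l *\<^sub>v ?b - ?b"
    unfolding B_mat_def using minus_mult_distrib_mat_vec[OF C one_carrier_mat, of ?b] by simp
  finally have "B_mat l *\<^sub>v (- ?b) = - (C_mat l *\<^sub>v ?b - ?b)" .
  moreover have "- (v - ?b) = init_vec l"
    if "?b = init_vec l + v" "v \<in> carrier_vec (l\<^sup>2)" for v
  proof (rule eq_vecI)
    fix k assume k: "k < dim_vec (init_vec l)"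
    have "?b $ k = init_vec l $ k + v $ k"
      using that k by (subst that(1)) (simp add: init_vec_def)
    then show "(- (v - ?b)) $ k = init_vec l $ k"
      using that k by (simp add: init_vec_def pair_gf_vec_def)
  qed (use that in \<open>simp add: init_vec_def pair_gf_vec_def\<close>)
  ultimately show ?thesis
    using pair_gf_vec_eq[of l] C by simp
qed

text \<open>Words of length 0 and 1 have no matches and give 1 + l t; every longer word is counted
  in the entry of its first two letters.\<close>

lemma box_gf_eq: "box_gf l = 1 + of_nat l * fps_X + ones_vec l \<bullet> pair_gf_vec l"
proof (rule fps_ext)
  fix n
  have "ones_vec l \<bullet> pair_gf_vec l =
      fps_X\<^sup>2 * (\<Sum>k<l\<^sup>2. Abs_fps (\<lambda>n. pair_count l n (lex_pair l k)))"
    by (simp add: scalar_prod_def ones_vec_def pair_gf_vec_def atLeast0LessThan sum_distrib_left)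
  then have rhs: "fps_nth (ones_vec l \<bullet> pair_gf_vec l) n =
      (if n < 2 then 0 else \<Sum>i=1..l. \<Sum>j=1..l. pair_count l (n - 2) (i, j))"
    by (simp add: fps_X_power_mult_nth fps_sum_nth sum_lex_pair)
  have nil: "{v. v \<in> lists {1..l} \<and> length v = 0} = {[]}" by auto
  consider "n = 0" | "n = Suc 0" | m where "n = Suc (Suc m)"
    by (metis not0_implies_Suc)
  then show "fps_nth (box_gf l) n =
      fps_nth (1 + of_nat l * fps_X + ones_vec l \<bullet> pair_gf_vec l) n"
  proof cases
    case 1
    then show ?thesis unfolding fps_add_nth rhs fps_nth_box_gf by (simp only: 1 nil) simp
  next
    case 2
    then show ?thesis unfolding fps_add_nth rhs fps_nth_box_gf
      by (simp only: 2 sum_lists_length_Suc finite_atLeastAtMost nil) (simp add: fps_of_nat[symmetric])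
  next
    case 3
    then show ?thesis unfolding fps_add_nth rhs fps_nth_box_gf
      by (simp add: sum_lists_length_Suc pair_count_def fps_of_nat[symmetric])
  qed
qed

theorem theorem4:
  fixes l :: nat
  assumes "l \<ge> 2"
  shows "invertible_mat (B_mat l) \<and>
    box_gf l = 1 + of_nat l * fps_X - ones_vec l \<bullet> (mat_inv (B_mat l) *\<^sub>v init_vec l)"
proof
  define N where "N = - geometric_mat (step_mat l)"
  note B = B_mat_carrier[of l]
  have N: "N \<in> carrier_mat (l\<^sup>2) (l\<^sup>2)" by (simp add: N_def)
  have BN: "B_mat l * N = 1\<^sub>m (l\<^sup>2)" and NB: "N * B_mat l = 1\<^sub>m (l\<^sup>2)"
    unfolding B_mat_def C_mat_eq N_def by (rule geometric_mat_inverse[OF step_mat_carrier])+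
  have inv: "inverts_mat (B_mat l) N" "inverts_mat N (B_mat l)"
    using B N BN NB by (auto simp: inverts_mat_def)
  then show "invertible_mat (B_mat l)"
    using B by (auto simp: invertible_mat_def)
  \<comment> \<open>Writing I as B (-b) lets the inverse cancel, leaving -b without computing any
    entry of the inverse.\<close>
  have "mat_inv (B_mat l) *\<^sub>v init_vec l = N *\<^sub>v (B_mat l *\<^sub>v (- pair_gf_vec l))"
    by (simp add: mat_inv_eqI[OF inv] B_mat_mult_pair_gf_vec)
  also have "\<dots> = (N * B_mat l) *\<^sub>v (- pair_gf_vec l)"
    using B N by (intro assoc_mult_mat_vec[symmetric]) auto
  also have "\<dots> = - pair_gf_vec l"
    by (simp add: NB)
  finally show "box_gf l =
      1 + of_nat l * fps_X - ones_vec l \<bullet> (mat_inv (B_mat l) *\<^sub>v init_vec l)"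
    by (simp add: box_gf_eq ones_vec_def pair_gf_vec_def)
qed

end
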